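(* Let $f$ be a complex multilinear polynomial of degree three. (1) If $d\in\mathbb{N}$ is even, then the image of $f$ in $M_d(\mathbb{C})$ is a vector space (i.e., a complex linear subspace of $M_d(\mathbb{C})$). (2) If $d\in\mathbb{N}$ is odd and $d<17$, then the image of $f$ in $M_d(\mathbb{C})$ is a vector space (i.e., a complex linear subspace of $M_d(\mathbb{C})$).
   Context: A complex multilinear polynomial of degree three is an element of the free associative algebra $\mathbb{C}\langle x_1,x_2,x_3\rangle$ in noncommuting variables that is linear in each variable, i.e. of the form $$f(x_1,x_2,x_3)=\sum_{\sigma\in \mathfrak{S}_3}a_\sigma\, x_{\sigma(1)}x_{\sigma(2)}x_{\sigma(3)},\qquad a_\sigma\in\mathbb{C},$$ with not all $a_\sigma$ zero, where $\mathfrak{S}_3$ is the symmetric group on $\{1,2,3\}$. The image of $f$ in $M_d(\mathbb{C})$ (the algebra of $d\times d$ complex matrices) is the set of values $\{f(A_1,A_2,A_3) : A_1,A_2,A_3\in M_d(\mathbb{C})\}$. *)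

theory Defs
  imports
    "HOL-Library.Poly_Mapping"
    "HOL-Combinatorics.Permutations"
    "Jordan_Normal_Form.VS_Connect"
begin

datatype 'v nc_monom = Monom (letters: "'v list")

text \<open>Words under concatenation, written additively because \<^theory>\<open>HOL-Library.Poly_Mapping\<close>
  equips finitely supported functions on a \<^class>\<open>monoid_add\<close> with the convolution product:
  the ring \<open>'v nc_monom \<Rightarrow>\<^sub>0 complex\<close> is thereby the free associative unital algebra on \<open>'v\<close>.\<close>

instantiation nc_monom :: (type) monoid_add
begin

definition "0 = Monom []"
definition "u + v = Monom (letters u @ letters v)"

instance
  by standard (simp_all add: zero_nc_monom_def plus_nc_monom_def)

end

type_synonym 'v free_alg = "'v nc_monom \<Rightarrow>\<^sub>0 complex"

definition Const :: "complex \<Rightarrow> 'v free_alg" where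
  "Const c = Poly_Mapping.single 0 c"

definition Var :: "'v \<Rightarrow> 'v free_alg" where
  "Var i = Poly_Mapping.single (Monom [i]) 1"

text \<open>The variables are indexed by \<^typ>\<open>nat\<close>; only \<open>Var 1\<close>, \<open>Var 2\<close>, \<open>Var 3\<close> occur.\<close>

definition multilinear_deg3 :: "nat free_alg \<Rightarrow> bool" where
  "multilinear_deg3 f \<longleftrightarrow>
     (\<exists>a. (\<exists>\<sigma>. \<sigma> permutes {1, 2, 3} \<and> a \<sigma> \<noteq> 0) \<and>
          f = (\<Sum>\<sigma> | \<sigma> permutes {1, 2, 3}.
                 Const (a \<sigma>) * Var (\<sigma> 1) * Var (\<sigma> 2) * Var (\<sigma> 3)))"

definition eval_monom :: "nat \<Rightarrow> ('v \<Rightarrow> complex mat) \<Rightarrow> 'v nc_monom \<Rightarrow> complex mat" where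
  "eval_monom d A w = foldr (\<lambda>i M. A i * M) (letters w) (1\<^sub>m d)"

text \<open>Meaningful only if every letter of \<open>f\<close> is sent by \<open>A\<close> into \<open>carrier_mat d d\<close>. The sum is
  a \<^const>\<open>finsum\<close> because the type of matrices of all sizes has no zero element.\<close>

definition eval_mat :: "nat \<Rightarrow> ('v \<Rightarrow> complex mat) \<Rightarrow> 'v free_alg \<Rightarrow> complex mat" where
  "eval_mat d A f =
     finsum (module_mat TYPE(complex) d d)
       (\<lambda>w. Poly_Mapping.lookup f w \<cdot>\<^sub>m eval_monom d A w) (Poly_Mapping.keys f)"

definition image3 :: "nat \<Rightarrow> nat free_alg \<Rightarrow> complex mat set" where
  "image3 d f = {eval_mat d A f | A. \<forall>i\<in>{1, 2, 3}. A i \<in> carrier_mat d d}"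

lemma eval_monom_closed:
  assumes "\<forall>i\<in>set (letters w). A i \<in> carrier_mat d d"
  shows "eval_monom d A w \<in> carrier_mat d d"
proof -
  have "foldr (\<lambda>i M. A i * M) xs (1\<^sub>m d) \<in> carrier_mat d d"
    if "\<forall>i\<in>set xs. A i \<in> carrier_mat d d" for xs
    using that by (induction xs) auto
  with assms show ?thesis by (simp add: eval_monom_def)
qed

lemma Const_Var_Var_Var:
  "Const c * Var i * Var j * Var k = Poly_Mapping.single (Monom [i, j, k]) c"
  by (simp add: Const_def Var_def mult_single plus_nc_monom_def zero_nc_monom_def)

lemma permutes_123_eqI:
  assumes "\<sigma> permutes {1, 2, 3::nat}" "\<tau> permutes {1, 2, 3}"
    and "\<sigma> 1 = \<tau> 1" "\<sigma> 2 = \<tau> 2" "\<sigma> 3 = \<tau> 3"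
  shows "\<sigma> = \<tau>"
proof
  fix x
  show "\<sigma> x = \<tau> x"
  proof (cases "x \<in> {1, 2, 3}")
    case True
    then show ?thesis using assms(3-5) by auto
  next
    case False
    then show ?thesis using assms(1,2) by (simp add: permutes_not_in)
  qed
qed

lemma eval_mat_multilinear:
  assumes A: "\<forall>i\<in>{1, 2, 3}. A i \<in> carrier_mat d d"
  shows "eval_mat d A (\<Sum>\<sigma> | \<sigma> permutes {1, 2, 3::nat}.
             Const (a \<sigma>) * Var (\<sigma> 1) * Var (\<sigma> 2) * Var (\<sigma> 3)) =
         finsum (module_mat TYPE(complex) d d)
           (\<lambda>\<sigma>. a \<sigma> \<cdot>\<^sub>m (A (\<sigma> 1) * A (\<sigma> 2) * A (\<sigma> 3))) {\<sigma>. \<sigma> permutes {1, 2, 3}}"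
proof -
  interpret M: abelian_group "module_mat TYPE(complex) d d"
    by (rule abelian_group_mat)
  define P where "P = {\<sigma>. \<sigma> permutes {1, 2, 3::nat}}"
  define W where "W = (\<lambda>\<sigma>::nat \<Rightarrow> nat. Monom [\<sigma> 1, \<sigma> 2, \<sigma> 3])"
  define f where "f = (\<Sum>\<sigma>\<in>P. Poly_Mapping.single (W \<sigma>) (a \<sigma>))"
  have fin: "finite P" by (simp add: P_def finite_permutations)
  have inj: "inj_on W P"
    unfolding P_def W_def by (rule inj_onI) (metis mem_Collect_eq nc_monom.inject list.inject permutes_123_eqI)
  have img: "\<sigma> i \<in> {1, 2, 3}" if "\<sigma> \<in> P" "i \<in> {1, 2, 3}" for \<sigma> i
    using that permutes_in_image[of \<sigma> "{1, 2, 3}" i] by (simp add: P_def)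
  have car: "A (\<sigma> i) \<in> carrier_mat d d" if "\<sigma> \<in> P" "i \<in> {1, 2, 3}" for \<sigma> i
    using img[OF that] A by blast
  have ev: "eval_monom d A (W \<sigma>) = A (\<sigma> 1) * A (\<sigma> 2) * A (\<sigma> 3)" if "\<sigma> \<in> P" for \<sigma>
    using car[OF that, of 1] car[OF that, of 2] car[OF that, of 3]
    by (simp add: eval_monom_def W_def)
  have closed: "eval_monom d A (W \<sigma>) \<in> carrier_mat d d" if "\<sigma> \<in> P" for \<sigma>
    using car[OF that] by (intro eval_monom_closed) (auto simp: W_def)
  have lk: "Poly_Mapping.lookup f (W \<sigma>) = a \<sigma>" if "\<sigma> \<in> P" for \<sigma>
  proof -
    have "Poly_Mapping.lookup f (W \<sigma>) = (\<Sum>\<tau>\<in>P. if \<tau> = \<sigma> then a \<tau> else 0)"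
      unfolding f_def lookup_sum lookup_single when_def
      by (rule sum.cong) (use inj that in \<open>auto dest: inj_onD\<close>)
    then show ?thesis using fin that by simp
  qed
  have sub: "Poly_Mapping.keys f \<subseteq> W ` P"
  proof -
    have "Poly_Mapping.keys f \<subseteq> (\<Union>\<sigma>\<in>P. Poly_Mapping.keys (Poly_Mapping.single (W \<sigma>) (a \<sigma>)))"
      unfolding f_def by (rule keys_sum)
    also have "\<dots> \<subseteq> W ` P" by (intro UN_least) (simp split: if_split)
    finally show ?thesis .
  qed
  have zero_smult: "0 \<cdot>\<^sub>m X = \<zero>\<^bsub>module_mat TYPE(complex) d d\<^esub>"
    if "X \<in> carrier_mat d d" for X
    using that by (auto simp: module_mat_simps)
  have term_closed: "c \<cdot>\<^sub>m eval_monom d A (W \<sigma>) \<in> carrier (module_mat TYPE(complex) d d)"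
    if "\<sigma> \<in> P" for c \<sigma>
    unfolding module_mat_simps by (rule smult_carrier_mat[OF closed[OF that]])
  have "eval_mat d A f = finsum (module_mat TYPE(complex) d d)
       (\<lambda>w. Poly_Mapping.lookup f w \<cdot>\<^sub>m eval_monom d A w) (W ` P)"
    unfolding eval_mat_def
  proof (rule M.add.finprod_mono_neutral_cong_left)
    show "finite (W ` P)" using fin by simp
    show "Poly_Mapping.keys f \<subseteq> W ` P" by (rule sub)
    show "Poly_Mapping.lookup f w \<cdot>\<^sub>m eval_monom d A w = \<zero>\<^bsub>module_mat TYPE(complex) d d\<^esub>"
      if "w \<in> W ` P - Poly_Mapping.keys f" for w
    proof -
      from that obtain \<sigma> where \<sigma>: "\<sigma> \<in> P" "w = W \<sigma>" by blast
      from that have "Poly_Mapping.lookup f w = 0" by (simp add: in_keys_iff)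
      then show ?thesis using zero_smult[OF closed[OF \<sigma>(1)]] \<sigma>(2) by simp
    qed
    show "(\<lambda>w. Poly_Mapping.lookup f w \<cdot>\<^sub>m eval_monom d A w)
        \<in> W ` P \<rightarrow> carrier (module_mat TYPE(complex) d d)"
      using term_closed by blast
  qed simp
  also have "\<dots> = finsum (module_mat TYPE(complex) d d)
       (\<lambda>\<sigma>. Poly_Mapping.lookup f (W \<sigma>) \<cdot>\<^sub>m eval_monom d A (W \<sigma>)) P"
    by (rule M.finsum_reindex[OF _ inj]) (use term_closed in blast)
  also have "\<dots> = finsum (module_mat TYPE(complex) d d)
       (\<lambda>\<sigma>. a \<sigma> \<cdot>\<^sub>m (A (\<sigma> 1) * A (\<sigma> 2) * A (\<sigma> 3))) P"
  proof (rule M.finsum_cong'[OF refl])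
    show "(\<lambda>\<sigma>. a \<sigma> \<cdot>\<^sub>m (A (\<sigma> 1) * A (\<sigma> 2) * A (\<sigma> 3)))
        \<in> P \<rightarrow> carrier (module_mat TYPE(complex) d d)"
      using term_closed by (metis (no_types, lifting) Pi_I ev)
    show "Poly_Mapping.lookup f (W \<sigma>) \<cdot>\<^sub>m eval_monom d A (W \<sigma>) =
        a \<sigma> \<cdot>\<^sub>m (A (\<sigma> 1) * A (\<sigma> 2) * A (\<sigma> 3))" if "\<sigma> \<in> P" for \<sigma>
      by (simp only: lk[OF that] ev[OF that])
  qed
  finally show ?thesis
    unfolding f_def W_def P_def Const_Var_Var_Var .
qed

end

theory Submission
  imports Defs "Jordan_Normal_Form.Column_Operations"
begin

text \<open>
  Write \<open>f = a1 XYZ + a2 YZX + a3 ZXY + b1 XZY + b2 ZYX + b3 YXZ\<close>. If the coefficients do not sum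
  to \<open>0\<close>, then \<open>f(A, 1, 1)\<close> is a nonzero multiple of \<open>A\<close>. Otherwise
  \<open>tr f = \<alpha> tr (X[Y, Z])\<close> with \<open>\<alpha> = a1 + a2 + a3\<close>, and the image turns out to be the space of
  trace zero matrices when \<open>\<alpha> = 0\<close> or \<open>d \<le> 1\<close>, and the whole matrix algebra in the remaining cases.

  The image is closed under similarity, and a nonscalar matrix is similar to one whose diagonal is
  zero outside two positions \<open>p, q\<close>, arbitrary (of the right sum) at these positions, and whose entry at
  \<open>(p, q)\<close> is nonzero. Such a matrix is a value of \<open>f\<close> with \<open>Y\<close> diagonal and \<open>X = 1 + \<xi> E\<^sub>q\<^sub>p\<close>,
  provided \<open>f(1, Y, Z) = c1 [Y, Z]\<close> with \<open>c1 \<noteq> 0\<close>. Setting \<open>Y\<close> or \<open>Z\<close> to \<open>1\<close> gives constants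
  \<open>c2, c3\<close> in the same way, and \<open>c1 + c2 + c3 = \<alpha>\<close>; if all three vanish, \<open>f\<close> is a Lie polynomial,
  for which \<open>[Y, [Y, X]]\<close> with \<open>Y\<close> diagonal suffices. If \<open>\<alpha> \<noteq> 0\<close> and \<open>d \<ge> 2\<close>, the identity matrix
  is a value of \<open>f\<close>, by block matrices with blocks of size \<open>2\<close> and \<open>3\<close>.
\<close>

section \<open>Similar matrices with prescribed diagonal\<close>

text \<open>Induction over the positions to be cleared. Once the entry at \<open>(p,k)\<close> is
  nonzero, subtracting a multiple of row \<open>p\<close> from row \<open>k\<close>, with the
  matching column operation, kills the entry at \<open>(k,k)\<close>. Among the diagonal entries
  only \<open>(p,p)\<close> changes besides, and the entry at \<open>(p,q)\<close> survives for the
  next round.\<close>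

lemma similar_mat_diag_zero:
  fixes A :: "'a::field mat"
  assumes A: "A \<in> carrier_mat d d" and pq: "p < d" "q < d" "p \<noteq> q" and nz: "A $$ (p,q) \<noteq> 0"
    and S: "finite S" "S \<subseteq> {..<d} - {p, q}"
  shows "\<exists>B \<in> carrier_mat d d. similar_mat A B \<and> B $$ (p,q) \<noteq> 0 \<and> (\<forall>k\<in>S. B $$ (k,k) = 0)"
  using S
proof (induction S rule: finite_induct)
  case empty
  then show ?case using A nz similar_mat_refl by blast
next
  case (insert k S)
  then obtain B where B: "B \<in> carrier_mat d d" "similar_mat A B" "B $$ (p,q) \<noteq> 0"
    "\<And>k. k \<in> S \<Longrightarrow> B $$ (k,k) = 0" by auto
  have k: "k < d" "k \<noteq> p" "k \<noteq> q" "k \<notin> S" and S: "\<And>j. j \<in> S \<Longrightarrow> j < d \<and> j \<noteq> p \<and> j \<noteq> q \<and> j \<noteq> k"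
    using insert by auto
  obtain C where C: "C \<in> carrier_mat d d" "similar_mat C B" "C $$ (p,q) \<noteq> 0" "C $$ (p,k) \<noteq> 0"
    "\<And>k. k \<in> S \<Longrightarrow> C $$ (k,k) = 0"
  proof (cases "B $$ (p,k) = 0")
    case True
    \<comment> \<open>Adding column \<open>q\<close> to column \<open>k\<close> copies the nonzero
      entry at \<open>(p,q)\<close> to \<open>(p,k)\<close>; on the diagonal only
      \<open>(k,k)\<close> and \<open>(q,q)\<close> change.\<close>
    show thesis
      by (rule that[of "add_col_sub_row 1 q k B"])
        (use B k pq S True in \<open>auto simp: add_col_sub_row_similar\<close>)
  qed (use B similar_mat_refl that in blast)
  define a where "a = C $$ (k,k) / C $$ (p,k)"
  define D where "D = add_col_sub_row a k p C"
  have "D \<in> carrier_mat d d" "similar_mat D C"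
    using C k pq unfolding D_def by (auto intro!: add_col_sub_row_similar)
  moreover have "D $$ (p,q) \<noteq> 0" "\<forall>j\<in>insert k S. D $$ (j,j) = 0"
    using C k pq S unfolding D_def a_def by auto
  moreover have "similar_mat A D"
    using similar_mat_trans[OF B(2) similar_mat_sym[OF similar_mat_trans[OF \<open>similar_mat D C\<close> C(2)]]] .
  ultimately show ?case by blast
qed

text \<open>A diagonal nonscalar matrix has two distinct diagonal entries, and adding column
  \<open>p\<close> to column \<open>q\<close> while subtracting row \<open>q\<close> from row
  \<open>p\<close> puts their difference at \<open>(p,q)\<close>.\<close>

lemma similar_mat_offdiag_nonzero:
  fixes A :: "'a::field mat"
  assumes A: "A \<in> carrier_mat d d" and ns: "\<And>c. A \<noteq> c \<cdot>\<^sub>m 1\<^sub>m d"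
  obtains B p q where "B \<in> carrier_mat d d" "similar_mat A B" "p < d" "q < d" "p \<noteq> q" "B $$ (p,q) \<noteq> 0"
proof (cases "\<exists>p<d. \<exists>q<d. p \<noteq> q \<and> A $$ (p,q) \<noteq> 0")
  case True
  then show thesis using that[OF A similar_mat_refl[OF A]] by blast
next
  case False
  have "\<exists>p<d. \<exists>q<d. A $$ (p,p) \<noteq> A $$ (q,q)"
  proof (rule ccontr)
    assume "\<not> ?thesis"
    then have "\<exists>c. \<forall>i<d. A $$ (i,i) = c" by metis
    then obtain c where "\<forall>i<d. A $$ (i,i) = c" ..
    then have "A = c \<cdot>\<^sub>m 1\<^sub>m d"
      using A False by (intro eq_matI) auto
    then show False using ns by blast
  qed
  then obtain p q where pq: "p < d" "q < d" "A $$ (p,p) \<noteq> A $$ (q,q)" by blast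
  then have "p \<noteq> q" "A $$ (p,q) = 0" "A $$ (q,p) = 0"
    using False by auto
  then show thesis
    by (intro that[of "add_col_sub_row 1 p q A" p q])
      (use A pq in \<open>auto intro!: similar_mat_sym[OF add_col_sub_row_similar]\<close>)
qed

text \<open>Since the entry at \<open>(p,q)\<close> is nonzero, adding a multiple of column
  \<open>q\<close> to column \<open>p\<close> shifts the entry at \<open>(p,p)\<close> by any
  amount. The positions are chosen before \<open>\<delta>\<close> because the value needed later
  depends on them.\<close>

lemma similar_mat_prescribed_diag:
  fixes A :: "'a::field mat"
  assumes A: "A \<in> carrier_mat d d" and ns: "\<And>c. A \<noteq> c \<cdot>\<^sub>m 1\<^sub>m d"
  obtains p q where "p < d" "q < d" "p \<noteq> q"
    "\<And>\<delta>. \<exists>B \<in> carrier_mat d d. similar_mat A B \<and> B $$ (p,q) \<noteq> 0 \<and> B $$ (p,p) = \<delta> \<and>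
         (\<forall>k<d. k \<noteq> p \<longrightarrow> k \<noteq> q \<longrightarrow> B $$ (k,k) = 0)"
proof -
  obtain A' p q where A': "A' \<in> carrier_mat d d" "similar_mat A A'"
    and pq: "p < d" "q < d" "p \<noteq> q" and nz: "A' $$ (p,q) \<noteq> 0"
    using similar_mat_offdiag_nonzero[OF A ns] by metis
  obtain B where B: "B \<in> carrier_mat d d" "similar_mat A' B" "B $$ (p,q) \<noteq> 0"
    "\<forall>k\<in>{..<d} - {p,q}. B $$ (k,k) = 0"
    using similar_mat_diag_zero[OF A'(1) pq nz, of "{..<d} - {p,q}"] by blast
  have "\<exists>C \<in> carrier_mat d d. similar_mat A C \<and> C $$ (p,q) \<noteq> 0 \<and> C $$ (p,p) = \<delta> \<and>
         (\<forall>k<d. k \<noteq> p \<longrightarrow> k \<noteq> q \<longrightarrow> C $$ (k,k) = 0)" for \<delta>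
  proof -
    define C where "C = add_col_sub_row ((\<delta> - B $$ (p,p)) / B $$ (p,q)) q p B"
    have "C \<in> carrier_mat d d" "similar_mat C B"
      using B pq unfolding C_def by (auto intro!: add_col_sub_row_similar)
    moreover have "C $$ (p,q) \<noteq> 0" "C $$ (p,p) = \<delta>" "\<forall>k<d. k \<noteq> p \<longrightarrow> k \<noteq> q \<longrightarrow> C $$ (k,k) = 0"
      using B pq unfolding C_def by auto
    moreover have "similar_mat A C"
      using similar_mat_trans[OF similar_mat_trans[OF A'(2) B(2)] similar_mat_sym[OF \<open>similar_mat C B\<close>]] .
    ultimately show ?thesis by blast
  qed
  with pq show thesis using that by blast
qed

section \<open>Multilinear polynomials of degree three\<close>

definition mat_trace :: "'a::comm_monoid_add mat \<Rightarrow> 'a" where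
  "mat_trace A = (\<Sum>i<dim_row A. A $$ (i,i))"

lemma mat_trace_mult_commute:
  fixes A B :: "'a::comm_semiring_0 mat"
  assumes "A \<in> carrier_mat m n" "B \<in> carrier_mat n m"
  shows "mat_trace (A * B) = mat_trace (B * A)"
proof -
  have "mat_trace (A * B) = (\<Sum>i<m. \<Sum>k<n. A $$ (i,k) * B $$ (k,i))"
    using assms by (auto simp: mat_trace_def scalar_prod_def lessThan_atLeast0 intro!: sum.cong)
  also have "\<dots> = (\<Sum>k<n. \<Sum>i<m. B $$ (k,i) * A $$ (i,k))"
    by (subst sum.swap) (simp add: mult.commute)
  also have "\<dots> = mat_trace (B * A)"
    using assms by (auto simp: mat_trace_def scalar_prod_def lessThan_atLeast0 intro!: sum.cong)
  finally show ?thesis .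
qed

lemma mat_trace_similar:
  fixes A :: "'a::comm_semiring_1 mat"
  assumes "similar_mat A B"
  shows "mat_trace A = mat_trace B"
proof -
  obtain n P Q where *: "{A, B, P, Q} \<subseteq> carrier_mat n n" "Q * P = 1\<^sub>m n" "A = P * B * Q"
    using similar_matD[OF assms] by blast
  then have "mat_trace A = mat_trace (Q * (P * B))"
    using mat_trace_mult_commute[of "P * B" n n Q] mult_carrier_mat[of P n n B n] by blast
  also have "Q * (P * B) = B"
    using * assoc_mult_mat[of Q n n P n B n] left_mult_one_mat[of B n n] by (metis insert_subset)
  finally show ?thesis .
qed

lemma mat_trace_add:
  assumes "A \<in> carrier_mat n n" "B \<in> carrier_mat n n"
  shows "mat_trace (A + B) = mat_trace A + mat_trace B"
  using assms by (simp add: mat_trace_def sum.distrib)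

lemma mat_trace_smult:
  fixes A :: "'a::semiring_0 mat"
  assumes "A \<in> carrier_mat n n"
  shows "mat_trace (c \<cdot>\<^sub>m A) = c * mat_trace A"
  using assms by (simp add: mat_trace_def sum_distrib_left)

section \<open>The generic polynomial as a trilinear map on matrices\<close>

definition trilin ::
  "'a::comm_ring_1 \<Rightarrow> 'a \<Rightarrow> 'a \<Rightarrow> 'a \<Rightarrow> 'a \<Rightarrow> 'a \<Rightarrow> 'a mat \<Rightarrow> 'a mat \<Rightarrow> 'a mat \<Rightarrow> 'a mat" where
  "trilin a1 a2 a3 b1 b2 b3 X Y Z =
     a1 \<cdot>\<^sub>m (X * Y * Z) + a2 \<cdot>\<^sub>m (Y * Z * X) + a3 \<cdot>\<^sub>m (Z * X * Y) +
     b1 \<cdot>\<^sub>m (X * Z * Y) + b2 \<cdot>\<^sub>m (Z * Y * X) + b3 \<cdot>\<^sub>m (Y * X * Z)"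

lemma trilin_carrier [simp]:
  assumes "X \<in> carrier_mat d d" "Y \<in> carrier_mat d d" "Z \<in> carrier_mat d d"
  shows "trilin a1 a2 a3 b1 b2 b3 X Y Z \<in> carrier_mat d d"
  using assms unfolding trilin_def by (intro add_carrier_mat smult_carrier_mat mult_carrier_mat)

text \<open>The \<open>a\<close> belong to the even words and the \<open>b\<close> to the odd ones,
  so a cyclic renaming of the arguments permutes each triple cyclically. Results that single out one
  argument thereby transfer to the other two.\<close>

lemma trilin_rotate:
  assumes "X \<in> carrier_mat d d" "Y \<in> carrier_mat d d" "Z \<in> carrier_mat d d"
  shows "trilin a1 a2 a3 b1 b2 b3 X Y Z = trilin a2 a3 a1 b3 b1 b2 Y Z X"
proof -
  have perm: "A + B + C + D + E + F = B + C + A + F + D + E"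
    if "A \<in> carrier_mat d d" "B \<in> carrier_mat d d" "C \<in> carrier_mat d d"
      "D \<in> carrier_mat d d" "E \<in> carrier_mat d d" "F \<in> carrier_mat d d"
    for A B C D E F :: "'a mat"
    using that by (intro eq_matI) (auto simp: ac_simps)
  show ?thesis
    unfolding trilin_def using assms by (intro perm smult_carrier_mat mult_carrier_mat)
qed

text \<open>A diagonal argument only rescales entries. The three words with \<open>X\<close> left of
  \<open>Z\<close> merge into one sum over \<open>k\<close>, weighted by \<open>y\<close> at the
  row, the summation index or the column; likewise the three with \<open>Z\<close> left of
  \<open>X\<close>.\<close>

lemma trilin_mat_diag:
  assumes "X \<in> carrier_mat d d" "Z \<in> carrier_mat d d" "i < d" "j < d"
  shows "trilin a1 a2 a3 b1 b2 b3 X (mat_diag d y) Z $$ (i,j) =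
    (\<Sum>k<d. X $$ (i,k) * Z $$ (k,j) * (b3 * y i + a1 * y k + b1 * y j) +
            Z $$ (i,k) * X $$ (k,j) * (a2 * y i + b2 * y k + a3 * y j))"
proof -
  let ?Y = "mat_diag d y"
  have YM: "?Y * M = mat d d (\<lambda>(i,j). y i * M $$ (i,j))"
    and MY: "M * ?Y = mat d d (\<lambda>(i,j). M $$ (i,j) * y j)" if "M \<in> carrier_mat d d" for M
    using that by (simp_all add: mat_diag_mult_left[of _ d d] mat_diag_mult_right[of _ d d])
  have mult: "(M * N) $$ (i,j) = (\<Sum>k<d. M $$ (i,k) * N $$ (k,j))"
    if "M \<in> carrier_mat d d" "N \<in> carrier_mat d d" for M N :: "'a mat"
    using that assms(3,4) by (simp add: scalar_prod_def lessThan_atLeast0)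
  have Y: "?Y \<in> carrier_mat d d" by (simp add: mat_diag_def)
  note XYZ = assms(1) Y assms(2)
  have "trilin a1 a2 a3 b1 b2 b3 X ?Y Z $$ (i,j) =
      a1 * ((X * ?Y) * Z) $$ (i,j) + a2 * (?Y * (Z * X)) $$ (i,j) + a3 * ((Z * X) * ?Y) $$ (i,j) +
      b1 * ((X * Z) * ?Y) $$ (i,j) + b2 * ((Z * ?Y) * X) $$ (i,j) + b3 * (?Y * (X * Z)) $$ (i,j)"
    unfolding trilin_def assoc_mult_mat[OF Y assms(2,1)] assoc_mult_mat[OF Y assms(1,2)]
    using mult_carrier_mat[OF mult_carrier_mat[OF XYZ(1,2)] XYZ(3)]
      mult_carrier_mat[OF Y mult_carrier_mat[OF XYZ(3,1)]]
      mult_carrier_mat[OF mult_carrier_mat[OF XYZ(3,1)] Y]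
      mult_carrier_mat[OF mult_carrier_mat[OF XYZ(1,3)] Y]
      mult_carrier_mat[OF mult_carrier_mat[OF XYZ(3,2)] XYZ(1)]
      mult_carrier_mat[OF Y mult_carrier_mat[OF XYZ(1,3)]] assms(3,4)
    by (simp del: index_mult_mat)
  also have "\<dots> = (\<Sum>k<d. a1 * (X $$ (i,k) * y k * Z $$ (k,j)) + a2 * (y i * (Z $$ (i,k) * X $$ (k,j)))
      + a3 * (Z $$ (i,k) * X $$ (k,j) * y j) + b1 * (X $$ (i,k) * Z $$ (k,j) * y j)
      + b2 * (Z $$ (i,k) * y k * X $$ (k,j)) + b3 * (y i * (X $$ (i,k) * Z $$ (k,j))))"
    using XYZ assms(3,4) mult_carrier_mat[OF assms(1,2)] mult_carrier_mat[OF assms(2,1)]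
    by (simp add: YM MY mult sum.distrib sum_distrib_left sum_distrib_right del: index_mult_mat)
  also have "\<dots> = (\<Sum>k<d. X $$ (i,k) * Z $$ (k,j) * (b3 * y i + a1 * y k + b1 * y j) +
      Z $$ (i,k) * X $$ (k,j) * (a2 * y i + b2 * y k + a3 * y j))"
    by (intro sum.cong refl) (simp add: algebra_simps)
  finally show ?thesis .
qed

text \<open>Conjugation is linear and, by \<open>Q * P = 1\<close>, multiplicative, so it commutes
  with the polynomial.\<close>

lemma trilin_similar:
  assumes "similar_mat A B" and B: "B = trilin a1 a2 a3 b1 b2 b3 X Y Z"
    and XYZ: "X \<in> carrier_mat d d" "Y \<in> carrier_mat d d" "Z \<in> carrier_mat d d"
  shows "\<exists>X \<in> carrier_mat d d. \<exists>Y \<in> carrier_mat d d. \<exists>Z \<in> carrier_mat d d. A = trilin a1 a2 a3 b1 b2 b3 X Y Z"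
proof -
  have "B \<in> carrier_mat d d" using assms by simp
  then obtain P Q where PQ: "P \<in> carrier_mat d d" "Q \<in> carrier_mat d d" "Q * P = 1\<^sub>m d" "A = P * B * Q"
    using similar_matD[OF assms(1)] by auto
  define c where "c M = P * M * Q" for M
  have c [simp]: "c M \<in> carrier_mat d d" if "M \<in> carrier_mat d d" for M
    using that PQ by (simp add: c_def)
  have c_mult: "c M * c N = c (M * N)" if M: "M \<in> carrier_mat d d" and N: "N \<in> carrier_mat d d" for M N
  proof -
    have "c M * c N = P * M * (Q * P) * (N * Q)"
      unfolding c_def using M N PQ(1,2) by (simp add: assoc_mult_mat[of _ d d _ d _ d])
    then show ?thesis unfolding c_def PQ(3) using M N PQ(1,2) by (simp add: assoc_mult_mat[of _ d d _ d _ d])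
  qed
  have c_add: "c (M + N) = c M + c N" if "M \<in> carrier_mat d d" "N \<in> carrier_mat d d" for M N
    using that PQ(1,2) by (simp add: c_def mult_add_distrib_mat[of _ d d] add_mult_distrib_mat[of _ d d])
  have c_smult: "c (r \<cdot>\<^sub>m M) = r \<cdot>\<^sub>m c M" if "M \<in> carrier_mat d d" for M r
    using that PQ(1,2) by (simp add: c_def mult_smult_distrib[of _ d d] mult_smult_assoc_mat[of _ d d])
  have "A = trilin a1 a2 a3 b1 b2 b3 (c X) (c Y) (c Z)"
    using XYZ PQ(4) by (simp add: B trilin_def c_mult c_def[symmetric] c_add c_smult)
  then show ?thesis using XYZ c by blast
qed

lemma mat_trace_trilin:
  assumes XYZ: "X \<in> carrier_mat d d" "Y \<in> carrier_mat d d" "Z \<in> carrier_mat d d"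
  shows "mat_trace (trilin a1 a2 a3 b1 b2 b3 X Y Z) =
    (a1 + a2 + a3) * mat_trace (X * Y * Z) + (b1 + b2 + b3) * mat_trace (X * Z * Y)"
proof -
  have rot: "mat_trace (M * N * R) = mat_trace (R * M * N)"
    if "M \<in> carrier_mat d d" "N \<in> carrier_mat d d" "R \<in> carrier_mat d d" for M N R :: "'a mat"
    using that mat_trace_mult_commute[of "M * N" d d R] by simp
  show ?thesis
    using XYZ rot[of Y Z X] rot[of Z X Y] rot[of Z Y X] rot[of Y X Z]
    by (simp add: trilin_def mat_trace_add[of _ d] mat_trace_smult[of _ d] algebra_simps)
qed

text \<open>With \<open>Y\<close> diagonal and \<open>X = 1 + \<xi> E\<^sub>q\<^sub>p\<close>, the off-diagonal equations form a triangular system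
  for \<open>Z\<close>, because \<open>f(1, Y, Z)\<close> is a nonzero multiple of \<open>[Y, Z]\<close>. The diagonal of
  \<open>f(\<xi> E\<^sub>q\<^sub>p, Y, Z)\<close> lives in positions \<open>p\<close> and \<open>q\<close> only and is controlled by \<open>Z\<^sub>p\<^sub>q\<close>.\<close>

lemma trilin_solve_offdiag:
  fixes B :: "'a::field mat"
  assumes B: "B \<in> carrier_mat d d"
    and c: "a1 + a2 + b3 \<noteq> 0" and sum0: "a1 + a2 + a3 + b1 + b2 + b3 = 0"
    and y: "inj_on y {..<d}"
    and pq: "p < d" "q < d" "p \<noteq> q"
    and w: "w = B $$ (p,q) / ((a1 + a2 + b3) * (y p - y q))"
    and Bp: "B $$ (p,p) = \<xi> * w * ((a2 + a3) * y p + b2 * y q)"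
    and Bq: "B $$ (q,q) = \<xi> * w * ((b1 + b3) * y q + a1 * y p)"
    and B0: "\<And>k. k < d \<Longrightarrow> k \<noteq> p \<Longrightarrow> k \<noteq> q \<Longrightarrow> B $$ (k,k) = 0"
  shows "\<exists>X \<in> carrier_mat d d. \<exists>Z \<in> carrier_mat d d. B = trilin a1 a2 a3 b1 b2 b3 X (mat_diag d y) Z"
proof -
  \<comment> \<open>\<open>L\<close> and \<open>M\<close> are the weights of the \<open>X Z\<close>
    and \<open>Z X\<close> terms. \<open>W\<close> solves the off-diagonal equations for
    \<open>X = 1\<close>, and \<open>V\<close> corrects it for
    \<open>\<xi> E\<^sub>q\<^sub>p\<close>. The correction changes only row \<open>q\<close> and
    column \<open>p\<close> but is computed from row \<open>p\<close> and column \<open>q\<close>,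
    so it does not feed back.\<close>
  define L where "L i k j = b3 * y i + a1 * y k + b1 * y j" for i k j
  define M where "M i k j = a2 * y i + b2 * y k + a3 * y j" for i k j
  define c where "c = a1 + a2 + b3"
  define W where "W i j = (if i = j then 0 else B $$ (i,j) / (c * (y i - y j)))" for i j
  define V where "V i j = W i j - (if i = j then 0 else
      ((if i = q then \<xi> * W p j * L q p j else 0) + (if j = p then \<xi> * W i q * M i q p else 0))
      / (c * (y i - y j)))" for i j
  define D :: "nat \<Rightarrow> nat \<Rightarrow> 'a" where "D k i = (if k = i then 1 else 0)" for k i
  define X where "X = mat d d (\<lambda>(i,j). D j i + D j p * (\<xi> * D i q))"
  define Z where "Z = mat d d (\<lambda>(i,j). V i j)"
  have XZ: "X \<in> carrier_mat d d" "Z \<in> carrier_mat d d" by (simp_all add: X_def Z_def)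
  have "b1 + b2 + a3 + c = 0" using sum0 unfolding c_def by (simp only: ac_simps)
  then have "b1 + b2 + a3 = - c" by (rule eq_neg_iff_add_eq_0[THEN iffD2])
  \<comment> \<open>This is the coefficient of \<open>Z\<^sub>i\<^sub>j\<close> in
    \<open>f(1, Y, Z)\<close>; the vanishing coefficient sum makes it that of
    \<open>c [Y, Z]\<close>.\<close>
  then have LM: "L i i j + M i j j = c * (y i - y j)" for i j
  proof -
    have "L i i j + M i j j = c * y i + (b1 + b2 + a3) * y j"
      by (simp add: L_def M_def c_def algebra_simps)
    then show ?thesis unfolding \<open>b1 + b2 + a3 = - c\<close> by (simp add: algebra_simps)
  qed
  have c0: "c \<noteq> 0" using assms(2) by (simp add: c_def)
  have yne: "y i - y j \<noteq> 0" if "i < d" "j < d" "i \<noteq> j" for i j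
    using that y by (auto dest: inj_onD)
  have "trilin a1 a2 a3 b1 b2 b3 X (mat_diag d y) Z $$ (i,j) = B $$ (i,j)" if ij: "i < d" "j < d" for i j
  proof -
    have D_sum: "(\<Sum>k<d. D k m * g k) = g m" if "m < d" for m and g :: "nat \<Rightarrow> 'a"
    proof -
      have "(\<Sum>k<d. D k m * g k) = (\<Sum>k<d. if k = m then g k else 0)"
        by (intro sum.cong) (simp_all add: D_def)
      then show ?thesis using that by simp
    qed
    have X: "X $$ (i,k) = D k i + D k p * (\<xi> * D i q)"
      "X $$ (k,j) = D k j + D k q * (\<xi> * D j p)" if "k < d" for k
      using that ij by (simp_all add: X_def D_def)
    have "trilin a1 a2 a3 b1 b2 b3 X (mat_diag d y) Z $$ (i,j) =
        (\<Sum>k<d. X $$ (i,k) * V k j * L i k j + V i k * X $$ (k,j) * M i k j)"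
      unfolding trilin_mat_diag[OF XZ ij]
      by (intro sum.cong refl) (use ij in \<open>simp add: Z_def L_def M_def\<close>)
    also have "\<dots> = (\<Sum>k<d. D k i * (V k j * L i k j) + D k p * (\<xi> * D i q * V k j * L i k j)
        + D k j * (V i k * M i k j) + D k q * (\<xi> * D j p * V i k * M i k j))"
      by (intro sum.cong refl) (simp add: X distrib_left distrib_right mult.assoc mult.left_commute)
    also have "\<dots> = V i j * (L i i j + M i j j) + \<xi> * D i q * V p j * L i p j + \<xi> * D j p * V i q * M i q j"
      using ij pq by (simp only: sum.distrib D_sum) (simp add: algebra_simps)
    also have "\<dots> = V i j * (L i i j + M i j j) + (if i = q then \<xi> * V p j * L q p j else 0)
        + (if j = p then \<xi> * V i q * M i q p else 0)"
      by (simp add: D_def)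
    also have "\<dots> = B $$ (i,j)"
    proof (cases "i = j")
      case True
      \<comment> \<open>On the diagonal \<open>V\<close> vanishes, so only the \<open>\<xi>\<close>
        terms at \<open>p\<close> and \<open>q\<close> remain, both governed by
        \<open>V p q = w\<close>.\<close>
      have "W p q = w" using pq by (simp add: W_def w c_def)
      moreover have "V p q = W p q" using pq by (simp add: V_def W_def)
      moreover have "V i i = 0" by (simp add: V_def W_def)
      ultimately show ?thesis
        using True pq ij Bp Bq B0[of i] by (auto simp: L_def M_def algebra_simps)
    next
      case False
      have "V p j = W p j" if "i = q" using pq that False by (auto simp: V_def W_def)
      moreover have "V i q = W i q" if "j = p" using pq that False by (auto simp: V_def W_def)
      moreover have "V i j * (c * (y i - y j)) = B $$ (i,j) -
         ((if i = q then \<xi> * W p j * L q p j else 0) + (if j = p then \<xi> * W i q * M i q p else 0))"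
        using c0 yne[OF ij False] False by (simp add: V_def W_def left_diff_distrib)
      ultimately show ?thesis unfolding LM by simp
    qed
    finally show ?thesis .
  qed
  then have "B = trilin a1 a2 a3 b1 b2 b3 X (mat_diag d y) Z"
    using B trilin_carrier[OF XZ(1) _ XZ(2), of "mat_diag d y" a1 a2 a3 b1 b2 b3]
    by (intro eq_matI) (auto simp: mat_diag_def)
  then show ?thesis using XZ by blast
qed

text \<open>The diagonal entries of \<open>f(X, Y, Z)\<close> for \<open>X\<close> superdiagonal with entries \<open>u\<close>, \<open>Y\<close> diagonal with
  entries \<open>y\<close>, and \<open>Z\<close> the subdiagonal shift. The solution is a direct sum of \<open>2 \<times> 2\<close> blocks and,
  for odd \<open>d\<close>, one \<open>3 \<times> 3\<close> block; for the latter, \<open>y\<close> comes from Cramer's rule. The junk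
  value \<open>y (0 - 1)\<close> is harmless as \<open>u 0 = 0\<close>.\<close>

lemma superdiagonal_sequence:
  fixes a b A B :: "'a::field"
  assumes "B * A - a * b \<noteq> 0" and d: "d \<noteq> 1" and ne: "A \<noteq> 0 \<or> B \<noteq> 0" and two: "(2::'a) \<noteq> 0"
  shows "\<exists>u y :: nat \<Rightarrow> 'a. u 0 = 0 \<and> u d = 0 \<and>
    (\<forall>i<d. u (Suc i) * (B * y i + a * y (Suc i)) + u i * (A * y i + b * y (i - 1)) = B * A - a * b)"
  using d
proof (induction d rule: nat_less_induct)
  case (1 d)
  \<comment> \<open>Splitting off a block of size 2 must not leave size 1, so 3 is a base
    case.\<close>
  consider "d = 0" | "d = 3" | e where "d = Suc (Suc e)" "e \<noteq> 1"
    using 1(2) by (cases d; cases "d - 1") auto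
  then show ?case
  proof cases
    case 1
    then show ?thesis by (intro exI[of _ "\<lambda>_. 0"]) auto
  next
    case 2
    \<comment> \<open>The linear system for \<open>y\<close> with \<open>u 1 = 1\<close>,
      \<open>u 2 = v\<close> has determinant \<open>v * (A + B * v) * (B * A - a * b)\<close>, whose
      last factor cancels against the right-hand side. One of \<open>v = 1\<close> and
      \<open>v = 2\<close> keeps the middle factor nonzero.\<close>
    obtain v where v: "v \<noteq> 0" "A + B * v \<noteq> 0"
    proof (cases "A + B = 0")
      case True
      then have "A = - B" by (rule eq_neg_iff_add_eq_0[THEN iffD2])
      then have "A + B * 2 = B" "B \<noteq> 0" using ne by simp_all
      then have "A + B * 2 \<noteq> 0" by metis
      then show thesis using that two by blast
    qed (use that[of 1] in auto)
    define N where "N = A + B * v"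
    define y where "y = (\<lambda>i::nat. if i = 0 then (N * A - a * b * v - a * A + a * a) / N
      else if i = 1 then (B * A - B * a - b * A) / N
      else (B * N - B * b * v - a * b + b * b * v) / (v * N))"
    define u where "u = (\<lambda>i::nat. if i = 1 then 1 else if i = 2 then v else 0)"
    have [simp]: "N \<noteq> 0" "v \<noteq> 0" using v by (simp_all add: N_def)
    have "B * y 0 + a * y 1 = B * A - a * b"
      by (simp add: y_def add_divide_distrib[symmetric] divide_eq_eq) (simp add: N_def algebra_simps)
    moreover have "v * (B * y 1 + a * y 2) + (A * y 1 + b * y 0) = B * A - a * b"
    proof -
      have "v * (B * y 1 + a * y 2) + (A * y 1 + b * y 0) =
          (v * B * (B * A - B * a - b * A) + a * (B * N - B * b * v - a * b + b * b * v)
           + A * (B * A - B * a - b * A) + b * (N * A - a * b * v - a * A + a * a)) / N"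
        by (simp add: y_def field_simps)
      then show ?thesis by (simp add: divide_eq_eq) (simp add: N_def algebra_simps)
    qed
    moreover have "v * (A * y 2 + b * y 1) = B * A - a * b"
    proof -
      have "v * (A * y 2 + b * y 1) =
          (A * (B * N - B * b * v - a * b + b * b * v) + v * b * (B * A - B * a - b * A)) / N"
        by (simp add: y_def field_simps)
      then show ?thesis by (simp add: divide_eq_eq) (simp add: N_def algebra_simps)
    qed
    ultimately have "u (Suc i) * (B * y i + a * y (Suc i)) + u i * (A * y i + b * y (i - 1)) = B * A - a * b"
      if "i < d" for i
      using that 2 by (auto simp: u_def less_Suc_eq numeral_3_eq_3 numeral_2_eq_2)
    moreover have "u 0 = 0" "u d = 0" using 2 by (simp_all add: u_def)
    ultimately show ?thesis by blast
  next
    case (3 e)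
    then obtain u y :: "nat \<Rightarrow> 'a" where uy: "u 0 = 0" "u e = 0"
      "\<And>i. i < e \<Longrightarrow> u (Suc i) * (B * y i + a * y (Suc i)) + u i * (A * y i + b * y (i - 1)) = B * A - a * b"
      using 1(1)[rule_format, of e] by auto
    \<comment> \<open>As \<open>u e = 0\<close>, the new block of size 2 decouples from the old
      ones; the values \<open>A - a\<close> and \<open>B - b\<close> solve its two
      equations.\<close>
    define u' where "u' = u(Suc e := 1, Suc (Suc e) := 0)"
    define y' where "y' = y(e := A - a, Suc e := B - b)"
    have "u' (Suc i) * (B * y' i + a * y' (Suc i)) + u' i * (A * y' i + b * y' (i - 1)) = B * A - a * b"
      if i: "i < d" for i
    proof -
      consider "Suc i < e" | "Suc i = e" | "i = e" | "i = Suc e" using i 3(1) by linarith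
      then show ?thesis
      proof cases
        case 1
        then have "i - 1 \<noteq> e" "i - 1 \<noteq> Suc e" by linarith+
        then show ?thesis using 1 uy(3)[of i] by (simp add: u'_def y'_def)
      next
        case 2
        then show ?thesis using uy(3)[of i] uy(2) by (auto simp: u'_def y'_def)
      qed (use uy(2) in \<open>simp_all add: u'_def y'_def algebra_simps\<close>)
    qed
    moreover have "u' 0 = 0" "u' d = 0" using uy(1) 3(1) by (simp_all add: u'_def)
    ultimately show ?thesis by blast
  qed
qed

section \<open>Images and their closure properties\<close>

definition trilin_image ::
  "nat \<Rightarrow> 'a::comm_ring_1 \<Rightarrow> 'a \<Rightarrow> 'a \<Rightarrow> 'a \<Rightarrow> 'a \<Rightarrow> 'a \<Rightarrow> 'a mat set" where
  "trilin_image d a1 a2 a3 b1 b2 b3 =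
     {trilin a1 a2 a3 b1 b2 b3 X Y Z | X Y Z.
        X \<in> carrier_mat d d \<and> Y \<in> carrier_mat d d \<and> Z \<in> carrier_mat d d}"

lemma trilin_imageI:
  assumes "X \<in> carrier_mat d d" "Y \<in> carrier_mat d d" "Z \<in> carrier_mat d d"
  shows "trilin a1 a2 a3 b1 b2 b3 X Y Z \<in> trilin_image d a1 a2 a3 b1 b2 b3"
  using assms unfolding trilin_image_def by blast

lemma trilin_image_carrier: "trilin_image d a1 a2 a3 b1 b2 b3 \<subseteq> carrier_mat d d"
  unfolding trilin_image_def by auto

lemma trilin_image_rotate:
  "trilin_image d a1 a2 a3 b1 b2 b3 = trilin_image d a2 a3 a1 b3 b1 b2"
  unfolding trilin_image_def
proof (intro Collect_cong iffI; elim exE conjE)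
  fix A X Y Z :: "'a mat"
  assume XYZ: "X \<in> carrier_mat d d" "Y \<in> carrier_mat d d" "Z \<in> carrier_mat d d"
  show "\<exists>X Y Z. A = trilin a2 a3 a1 b3 b1 b2 X Y Z \<and>
      X \<in> carrier_mat d d \<and> Y \<in> carrier_mat d d \<and> Z \<in> carrier_mat d d"
    if "A = trilin a1 a2 a3 b1 b2 b3 X Y Z"
    using trilin_rotate[OF XYZ, of a1 a2 a3 b1 b2 b3] that XYZ by metis
  show "\<exists>X Y Z. A = trilin a1 a2 a3 b1 b2 b3 X Y Z \<and>
      X \<in> carrier_mat d d \<and> Y \<in> carrier_mat d d \<and> Z \<in> carrier_mat d d"
    if "A = trilin a2 a3 a1 b3 b1 b2 X Y Z"
    using trilin_rotate[OF XYZ(3,1,2), of a1 a2 a3 b1 b2 b3] that XYZ by metis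
qed

lemma trilin_image_similar:
  assumes "similar_mat A B" "B \<in> trilin_image d a1 a2 a3 b1 b2 b3"
  shows "A \<in> trilin_image d a1 a2 a3 b1 b2 b3"
proof -
  obtain X Y Z where "B = trilin a1 a2 a3 b1 b2 b3 X Y Z"
    and "X \<in> carrier_mat d d" "Y \<in> carrier_mat d d" "Z \<in> carrier_mat d d"
    using assms(2) unfolding trilin_image_def by blast
  from trilin_similar[OF assms(1) this] show ?thesis unfolding trilin_image_def by blast
qed

lemma trilin_image_smult:
  fixes A :: "'a::comm_ring_1 mat"
  assumes "A \<in> trilin_image d a1 a2 a3 b1 b2 b3"
  shows "r \<cdot>\<^sub>m A \<in> trilin_image d a1 a2 a3 b1 b2 b3"
proof -
  obtain X Y Z where A: "A = trilin a1 a2 a3 b1 b2 b3 X Y Z"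
    and XYZ: "X \<in> carrier_mat d d" "Y \<in> carrier_mat d d" "Z \<in> carrier_mat d d"
    using assms unfolding trilin_image_def by blast
  have add: "r \<cdot>\<^sub>m (M + N) = r \<cdot>\<^sub>m M + r \<cdot>\<^sub>m N"
    if "M \<in> carrier_mat d d" "N \<in> carrier_mat d d" for M N :: "'a mat"
    using that by (intro eq_matI) (auto simp: distrib_left)
  have comm: "r \<cdot>\<^sub>m (c \<cdot>\<^sub>m M) = c \<cdot>\<^sub>m (r \<cdot>\<^sub>m M)" for c and M :: "'a mat"
    by (intro eq_matI) (auto simp: mult.left_commute)
  have "r \<cdot>\<^sub>m A = trilin a1 a2 a3 b1 b2 b3 (r \<cdot>\<^sub>m X) Y Z"
    using XYZ by (simp add: A trilin_def add comm mult_smult_distrib[of _ d d] mult_smult_assoc_mat[of _ d d])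
  then show ?thesis using trilin_imageI[of "r \<cdot>\<^sub>m X" d Y Z] XYZ by simp
qed

text \<open>The trace is \<open>a1 + a2 + a3\<close> times \<open>tr (XYZ) - tr (XZY)\<close>, and
  for \<open>d \<le> 1\<close> matrices commute.\<close>

lemma mat_trace_trilin_image:
  assumes "A \<in> trilin_image d a1 a2 a3 b1 b2 b3"
    and sum0: "a1 + a2 + a3 + b1 + b2 + b3 = 0" and "a1 + a2 + a3 = 0 \<or> d \<le> 1"
  shows "mat_trace A = 0"
proof -
  obtain X Y Z where A: "A = trilin a1 a2 a3 b1 b2 b3 X Y Z"
    and XYZ: "X \<in> carrier_mat d d" "Y \<in> carrier_mat d d" "Z \<in> carrier_mat d d"
    using assms(1) unfolding trilin_image_def by blast
  have b: "b1 + b2 + b3 = - (a1 + a2 + a3)"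
    using sum0 by (metis add.assoc add_eq_0_iff)
  have "mat_trace (X * Y * Z) = mat_trace (X * Z * Y)" if "d \<le> 1"
  proof -
    have "Y * Z = Z * Y"
      using XYZ that by (intro eq_matI) (auto simp: scalar_prod_def le_Suc_eq mult.commute)
    then show ?thesis using XYZ by (simp add: assoc_mult_mat[of _ d d _ d _ d])
  qed
  moreover have "mat_trace A = (a1 + a2 + a3) * (mat_trace (X * Y * Z) - mat_trace (X * Z * Y))"
    unfolding A mat_trace_trilin[OF XYZ] b by (simp only: right_diff_distrib mult_minus_left add_uminus_conv_diff)
  ultimately show ?thesis using assms(3) by auto
qed

section \<open>Nonscalar and scalar matrices as values\<close>

lemma nonscalar_in_trilin_image:
  fixes A :: "'a::field_char_0 mat"
  assumes A: "A \<in> carrier_mat d d" and ns: "\<And>c. A \<noteq> c \<cdot>\<^sub>m 1\<^sub>m d"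
    and c: "a1 + a2 + b3 \<noteq> 0" and sum0: "a1 + a2 + a3 + b1 + b2 + b3 = 0"
    and tr: "a1 + a2 + a3 \<noteq> 0 \<or> mat_trace A = 0"
  shows "A \<in> trilin_image d a1 a2 a3 b1 b2 b3"
proof -
  define \<alpha> where "\<alpha> = a1 + a2 + a3"
  obtain p q where pq: "p < d" "q < d" "p \<noteq> q"
    and ex: "\<And>\<delta>. \<exists>B \<in> carrier_mat d d. similar_mat A B \<and> B $$ (p,q) \<noteq> 0 \<and> B $$ (p,p) = \<delta> \<and>
         (\<forall>k<d. k \<noteq> p \<longrightarrow> k \<noteq> q \<longrightarrow> B $$ (k,k) = 0)"
    using similar_mat_prescribed_diag[OF A ns] by metis
  define y :: "nat \<Rightarrow> 'a" where "y = of_nat"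
  have y: "inj_on y {..<d}" by (simp add: y_def inj_on_def)
  have ypq: "y p - y q \<noteq> 0" using pq by (simp add: y_def)
  \<comment> \<open>With \<open>\<kappa>\<close> for \<open>\<xi> * w\<close>, the two diagonal
    conditions of \<open>trilin_solve_offdiag\<close> add up to
    \<open>\<kappa> * (\<alpha> * (y p - y q))\<close>, so the trace dictates
    \<open>\<kappa>\<close>. If \<open>\<alpha> = 0\<close>, the trace is zero and so is the
    quotient.\<close>
  define \<kappa> where "\<kappa> = mat_trace A / (\<alpha> * (y p - y q))"
  have \<kappa>: "\<kappa> * (\<alpha> * (y p - y q)) = mat_trace A"
    using tr ypq by (auto simp: \<kappa>_def \<alpha>_def)
  obtain B where B: "B \<in> carrier_mat d d" "similar_mat A B" "B $$ (p,q) \<noteq> 0"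
    and Bp: "B $$ (p,p) = \<kappa> * ((a2 + a3) * y p + b2 * y q)"
    and B0: "\<And>k. k < d \<Longrightarrow> k \<noteq> p \<Longrightarrow> k \<noteq> q \<Longrightarrow> B $$ (k,k) = 0"
    using ex by metis
  have b: "b1 + b2 + b3 = - \<alpha>"
    using sum0 unfolding \<alpha>_def by (metis add.assoc add_eq_0_iff)
  have "mat_trace B = B $$ (p,p) + B $$ (q,q)"
  proof -
    have "mat_trace B = (\<Sum>k\<in>{p,q}. B $$ (k,k))"
      unfolding mat_trace_def using B(1) pq B0 by (intro sum.mono_neutral_right) auto
    then show ?thesis using pq by simp
  qed
  then have "B $$ (q,q) = \<kappa> * (\<alpha> * (y p - y q)) - B $$ (p,p)"
    using \<kappa> mat_trace_similar[OF B(2)] by (simp add: algebra_simps)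
  also have "\<dots> = \<kappa> * ((b1 + b3) * y q + a1 * y p)"
  proof -
    have "\<alpha> * (y p - y q) = (a1 + a2 + a3) * y p + (b1 + b2 + b3) * y q"
      unfolding b by (simp add: \<alpha>_def algebra_simps)
    then show ?thesis unfolding Bp by (simp add: algebra_simps)
  qed
  finally have Bq: "B $$ (q,q) = \<kappa> * ((b1 + b3) * y q + a1 * y p)" .
  \<comment> \<open>The number \<open>w\<close> is known only once \<open>B\<close> is chosen, which
    is why \<open>\<kappa>\<close> was fixed first; now \<open>\<xi>\<close> is
    \<open>\<kappa> / w\<close>.\<close>
  define w where "w = B $$ (p,q) / ((a1 + a2 + b3) * (y p - y q))"
  have "w \<noteq> 0" using B(3) c ypq by (simp add: w_def)
  then have "\<kappa> = \<kappa> / w * w" by simp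
  then have "\<exists>X \<in> carrier_mat d d. \<exists>Z \<in> carrier_mat d d. B = trilin a1 a2 a3 b1 b2 b3 X (mat_diag d y) Z"
    using Bp Bq B0 by (intro trilin_solve_offdiag[OF B(1) c sum0 y pq w_def, of "\<kappa> / w"]) simp_all
  then have "B \<in> trilin_image d a1 a2 a3 b1 b2 b3"
    by (auto intro!: trilin_imageI simp: mat_diag_def)
  then show ?thesis using trilin_image_similar[OF B(2)] by blast
qed

text \<open>These coefficients are those of a Lie polynomial. For \<open>Y = Z\<close> diagonal, the value is \<open>X\<close> with
  the entry \<open>(i, j)\<close> scaled by \<open>- a3 (y\<^sub>i - y\<^sub>j)\<^sup>2\<close>.\<close>

lemma lie_trace_zero_in_trilin_image:
  fixes A :: "'a::field_char_0 mat"
  assumes A: "A \<in> carrier_mat d d" and ns: "\<And>c. A \<noteq> c \<cdot>\<^sub>m 1\<^sub>m d" and tr: "mat_trace A = 0"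
    and a: "a3 \<noteq> 0" "a1 + a2 + a3 = 0"
  shows "A \<in> trilin_image d a1 a2 a3 a2 a1 a3"
proof -
  obtain p q where pq: "p < d" "q < d" "p \<noteq> q"
    and ex: "\<exists>B \<in> carrier_mat d d. similar_mat A B \<and> B $$ (p,q) \<noteq> 0 \<and> B $$ (p,p) = 0 \<and>
         (\<forall>k<d. k \<noteq> p \<longrightarrow> k \<noteq> q \<longrightarrow> B $$ (k,k) = 0)"
    using similar_mat_prescribed_diag[OF A ns] by metis
  then obtain B where B: "B \<in> carrier_mat d d" "similar_mat A B" "B $$ (p,p) = 0"
    and B0: "\<And>k. k < d \<Longrightarrow> k \<noteq> p \<Longrightarrow> k \<noteq> q \<Longrightarrow> B $$ (k,k) = 0"
    by blast
  have "mat_trace B = (\<Sum>k\<in>{q}. B $$ (k,k))"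
    unfolding mat_trace_def using B(1,3) pq B0 by (intro sum.mono_neutral_right) auto
  then have "B $$ (q,q) = 0" using mat_trace_similar[OF B(2)] tr by simp
  then have Bdiag: "B $$ (k,k) = 0" if "k < d" for k using that B(3) B0 by metis
  define y :: "nat \<Rightarrow> 'a" where "y = of_nat"
  \<comment> \<open>The division by zero on the diagonal does no harm, as \<open>B\<close> vanishes
    there.\<close>
  define X where "X = mat d d (\<lambda>(i,j). - (B $$ (i,j)) / (a3 * (y i - y j)\<^sup>2))"
  have X: "X \<in> carrier_mat d d" and Y: "mat_diag d y \<in> carrier_mat d d"
    by (simp_all add: X_def mat_diag_def)
  have "trilin a1 a2 a3 a2 a1 a3 X (mat_diag d y) (mat_diag d y) $$ (i,j) = B $$ (i,j)"
    if ij: "i < d" "j < d" for i j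
  proof -
    have "trilin a1 a2 a3 a2 a1 a3 X (mat_diag d y) (mat_diag d y) $$ (i,j) =
        (\<Sum>k<d. (if k = j then X $$ (i,j) * y j * (a3 * y i + a1 * y j + a2 * y j) else 0) +
          (if k = i then y i * X $$ (i,j) * (a2 * y i + a1 * y i + a3 * y j) else 0))"
      unfolding trilin_mat_diag[OF X Y ij]
      by (intro sum.cong refl) (use ij in \<open>auto simp: mat_diag_def\<close>)
    also have "\<dots> = X $$ (i,j) * (y j * (a3 * y i + (a1 + a2) * y j) + y i * ((a1 + a2) * y i + a3 * y j))"
      using ij by (simp add: sum.distrib algebra_simps)
    also have "a1 + a2 = - a3" using a(2) by (simp add: eq_neg_iff_add_eq_0)
    also have "X $$ (i,j) * (y j * (a3 * y i + - a3 * y j) + y i * (- a3 * y i + a3 * y j))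
        = X $$ (i,j) * - (a3 * (y i - y j)\<^sup>2)"
      by (simp add: power2_eq_square algebra_simps)
    also have "\<dots> = B $$ (i,j)"
      using ij a(1) Bdiag by (cases "i = j") (simp_all add: X_def y_def)
    finally show ?thesis .
  qed
  then have "B = trilin a1 a2 a3 a2 a1 a3 X (mat_diag d y) (mat_diag d y)"
    using B(1) trilin_carrier[OF X Y Y, of a1 a2 a3 a2 a1 a3] by (intro eq_matI) auto
  then have "B \<in> trilin_image d a1 a2 a3 a2 a1 a3" using trilin_imageI[OF X Y Y] by metis
  then show ?thesis using trilin_image_similar[OF B(2)] by blast
qed

text \<open>For \<open>X\<close> superdiagonal, \<open>Y\<close> diagonal and \<open>Z\<close> the
  subdiagonal shift, the value is diagonal, with entries the left-hand sides of
  \<open>superdiagonal_sequence\<close> for \<open>A = a2 + a3\<close>, \<open>B = b1 + b3\<close>,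
  \<open>a = a1\<close>, \<open>b = b2\<close>. All of them equal \<open>D\<close>, and rescaling
  reaches every scalar.\<close>

lemma scalar_in_trilin_image:
  fixes a1 a2 a3 b1 b2 b3 :: "'a::field_char_0"
  assumes D: "(b1 + b3) * (a2 + a3) - a1 * b2 \<noteq> 0" and ne: "a2 + a3 \<noteq> 0 \<or> b1 + b3 \<noteq> 0"
    and d: "d \<noteq> 1"
  shows "r \<cdot>\<^sub>m 1\<^sub>m d \<in> trilin_image d a1 a2 a3 b1 b2 b3"
proof -
  define D where "D = (b1 + b3) * (a2 + a3) - a1 * b2"
  obtain u y :: "nat \<Rightarrow> 'a" where u: "u 0 = 0" "u d = 0"
    and uy: "\<And>i. i < d \<Longrightarrow> u (Suc i) * ((b1 + b3) * y i + a1 * y (Suc i)) +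
        u i * ((a2 + a3) * y i + b2 * y (i - 1)) = D"
    using superdiagonal_sequence[OF D d ne] unfolding D_def by auto
  define X where "X = mat d d (\<lambda>(i,j). if j = Suc i then u j else 0)"
  define Z where "Z = mat d d (\<lambda>(i,j). if i = Suc j then 1 else 0 :: 'a)"
  have XZ: "X \<in> carrier_mat d d" "Z \<in> carrier_mat d d" and Y: "mat_diag d y \<in> carrier_mat d d"
    by (simp_all add: X_def Z_def mat_diag_def)
  have "trilin a1 a2 a3 b1 b2 b3 X (mat_diag d y) Z $$ (i,j) = (D \<cdot>\<^sub>m 1\<^sub>m d) $$ (i,j)"
    if ij: "i < d" "j < d" for i j
  proof -
    have "trilin a1 a2 a3 b1 b2 b3 X (mat_diag d y) Z $$ (i,j) =
        (\<Sum>k<d. (if k = Suc i then if i = j then u k * (b3 * y i + a1 * y k + b1 * y j) else 0 else 0) +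
          (if k = i - 1 then if i = j \<and> i \<noteq> 0 then u i * (a2 * y i + b2 * y k + a3 * y j) else 0 else 0))"
      unfolding trilin_mat_diag[OF XZ ij]
      by (intro sum.cong refl) (use ij in \<open>auto simp: X_def Z_def\<close>)
    also have "\<dots> = (if i = j then (if Suc i < d then u (Suc i) * (b3 * y i + a1 * y (Suc i) + b1 * y i) else 0)
        + (if i \<noteq> 0 then u i * (a2 * y i + b2 * y (i - 1) + a3 * y i) else 0) else 0)"
      using ij by (auto simp: sum.distrib)
    also have "\<dots> = (if i = j then u (Suc i) * ((b1 + b3) * y i + a1 * y (Suc i)) +
        u i * ((a2 + a3) * y i + b2 * y (i - 1)) else 0)"
    proof -
      \<comment> \<open>The sum over \<open>k\<close> has no index \<open>d\<close>; its term in the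
        last row may be added because \<open>u d = 0\<close>.\<close>
      have "u (Suc i) = 0" if "\<not> Suc i < d" using that ij u(2) by (metis Suc_lessI)
      then show ?thesis using u(1) by (auto simp: algebra_simps)
    qed
    finally show ?thesis using ij uy by simp
  qed
  then have "D \<cdot>\<^sub>m 1\<^sub>m d = trilin a1 a2 a3 b1 b2 b3 X (mat_diag d y) Z"
    using trilin_carrier[OF XZ(1) Y XZ(2), of a1 a2 a3 b1 b2 b3] by (intro eq_matI) auto
  then have "D \<cdot>\<^sub>m 1\<^sub>m d \<in> trilin_image d a1 a2 a3 b1 b2 b3" using trilin_imageI[OF XZ(1) Y XZ(2)] by metis
  then have "(r / D) \<cdot>\<^sub>m (D \<cdot>\<^sub>m 1\<^sub>m d) \<in> trilin_image d a1 a2 a3 b1 b2 b3"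
    by (rule trilin_image_smult)
  moreover have "(r / D) \<cdot>\<^sub>m (D \<cdot>\<^sub>m 1\<^sub>m d) = r \<cdot>\<^sub>m 1\<^sub>m d"
    using D by (intro eq_matI) (auto simp: D_def)
  ultimately show ?thesis by simp
qed

section \<open>The two possible images\<close>

lemma trace_zero_in_trilin_image:
  fixes a1 a2 a3 b1 b2 b3 :: "'a::field_char_0"
  assumes sum0: "a1 + a2 + a3 + b1 + b2 + b3 = 0"
    and nz: "(a1, a2, a3, b1, b2, b3) \<noteq> (0, 0, 0, 0, 0, 0)"
    and A: "A \<in> carrier_mat d d" and tr: "mat_trace A = 0"
  shows "A \<in> trilin_image d a1 a2 a3 b1 b2 b3"
proof (cases "\<exists>c. A = c \<cdot>\<^sub>m 1\<^sub>m d")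
  case True
  then obtain c where c: "A = c \<cdot>\<^sub>m 1\<^sub>m d" ..
  then have "of_nat d * c = 0" using tr by (simp add: mat_trace_def)
  then have "A = 0\<^sub>m d d" using c by (intro eq_matI) auto
  moreover have "trilin a1 a2 a3 b1 b2 b3 (0\<^sub>m d d) (0\<^sub>m d d) (0\<^sub>m d d) = 0\<^sub>m d d"
    by (intro eq_matI) (auto simp: trilin_def scalar_prod_def)
  ultimately show ?thesis using trilin_imageI[of "0\<^sub>m d d" d "0\<^sub>m d d" "0\<^sub>m d d" a1 a2 a3 b1 b2 b3] by simp
next
  case False
  then have ns: "A \<noteq> c \<cdot>\<^sub>m 1\<^sub>m d" for c by blast
  note nonscalar = nonscalar_in_trilin_image[OF A ns _ _ disjI2[OF tr]]
  consider "a1 + a2 + b3 \<noteq> 0" | "a2 + a3 + b2 \<noteq> 0" | "a3 + a1 + b1 \<noteq> 0"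
    | "a1 + a2 + b3 = 0" "a2 + a3 + b2 = 0" "a3 + a1 + b1 = 0" by blast
  then show ?thesis
  proof cases
    case 1
    then show ?thesis using sum0 by (rule nonscalar)
  next
    case 2
    then have "A \<in> trilin_image d a2 a3 a1 b3 b1 b2"
      by (rule nonscalar) (use sum0 in \<open>simp add: ac_simps\<close>)
    then show ?thesis by (simp only: trilin_image_rotate[of d a1 a2 a3])
  next
    case 3
    then have "A \<in> trilin_image d a3 a1 a2 b2 b3 b1"
      by (rule nonscalar) (use sum0 in \<open>simp add: ac_simps\<close>)
    then show ?thesis by (simp only: trilin_image_rotate[of d a1 a2 a3] trilin_image_rotate[of d a2 a3 a1])
  next
    case 4
    \<comment> \<open>The three vanishing sums add up to \<open>a1 + a2 + a3\<close> plus the total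
      coefficient sum, so the former is zero, and each relation then equates an \<open>a\<close>
      with a \<open>b\<close>. The resulting pattern is stable under rotation, which can bring any
      nonzero coefficient to third place.\<close>
    have "a1 + a2 + a3 = (a1 + a2 + b3) + (a2 + a3 + b2) + (a3 + a1 + b1) - (a1 + a2 + a3 + b1 + b2 + b3)"
      by (simp add: algebra_simps)
    then have a: "a1 + a2 + a3 = 0" using 4 sum0 by simp
    have "b1 = (a3 + a1 + b1) - (a1 + a2 + a3) + a2" "b2 = (a2 + a3 + b2) - (a1 + a2 + a3) + a1"
      "b3 = (a1 + a2 + b3) - (a1 + a2 + a3) + a3" by (simp_all add: algebra_simps)
    then have b: "b1 = a2" "b2 = a1" "b3 = a3" using 4 a by simp_all
    have "a1 \<noteq> 0 \<or> a2 \<noteq> 0 \<or> a3 \<noteq> 0" using nz b by auto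
    moreover have "a2 + a3 + a1 = 0" "a3 + a1 + a2 = 0" using a by (simp_all add: ac_simps)
    note lie = lie_trace_zero_in_trilin_image[OF A ns tr _ a] lie_trace_zero_in_trilin_image[OF A ns tr _ this(1)]
      lie_trace_zero_in_trilin_image[OF A ns tr _ this(2)]
    ultimately show ?thesis
      using lie unfolding b trilin_image_rotate[of d a1 a2 a3] trilin_image_rotate[of d a3 a1 a2]
      by blast
  qed
qed

text \<open>As \<open>c1 + c2 + c3 = \<alpha>\<close> is nonzero, some rotation permits
  \<open>nonscalar_in_trilin_image\<close>. Scalar matrices need a rotation whose constant avoids
  both \<open>0\<close> and \<open>- \<alpha>\<close>.\<close>

lemma carrier_in_trilin_image:
  fixes a1 a2 a3 b1 b2 b3 :: "'a::field_char_0"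
  assumes sum0: "a1 + a2 + a3 + b1 + b2 + b3 = 0" and \<alpha>: "a1 + a2 + a3 \<noteq> 0" and d: "d \<noteq> 1"
    and A: "A \<in> carrier_mat d d"
  shows "A \<in> trilin_image d a1 a2 a3 b1 b2 b3"
proof -
  note rotate = trilin_image_rotate[of d a1 a2 a3] trilin_image_rotate[of d a2 a3 a1]
  define \<alpha> where "\<alpha> = a1 + a2 + a3"
  have \<alpha>0: "\<alpha> \<noteq> 0" using assms(2) by (simp add: \<alpha>_def)
  have b: "b1 + b2 + b3 = - \<alpha>"
    using sum0 unfolding \<alpha>_def by (metis add.assoc add_eq_0_iff)
  have sum0': "a2 + a3 + a1 + b3 + b1 + b2 = 0" "a3 + a1 + a2 + b2 + b3 + b1 = 0"
    and \<alpha>': "a2 + a3 + a1 \<noteq> 0" "a3 + a1 + a2 \<noteq> 0"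
    using sum0 assms(2) by (simp_all add: ac_simps)
  define c1 c2 c3 where "c1 = a1 + a2 + b3" and "c2 = a2 + a3 + b2" and "c3 = a3 + a1 + b1"
  have csum: "c1 + c2 + c3 = \<alpha>"
  proof -
    have "c1 + c2 + c3 = \<alpha> + (a1 + a2 + a3 + b1 + b2 + b3)"
      by (simp add: c1_def c2_def c3_def \<alpha>_def algebra_simps)
    then show ?thesis using sum0 by simp
  qed
  show ?thesis
  proof (cases "\<exists>r. A = r \<cdot>\<^sub>m 1\<^sub>m d")
    case False
    then have ns: "A \<noteq> r \<cdot>\<^sub>m 1\<^sub>m d" for r by blast
    have "c1 \<noteq> 0 \<or> c2 \<noteq> 0 \<or> c3 \<noteq> 0" using csum \<alpha>0 by auto
    then show ?thesis
      unfolding c1_def c2_def c3_def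
      using nonscalar_in_trilin_image[OF A ns _ sum0 disjI1[OF assms(2)]]
        nonscalar_in_trilin_image[OF A ns _ sum0'(1) disjI1[OF \<alpha>'(1)]]
        nonscalar_in_trilin_image[OF A ns _ sum0'(2) disjI1[OF \<alpha>'(2)]]
        rotate by blast
  next
    case True
    then obtain r where r: "A = r \<cdot>\<^sub>m 1\<^sub>m d" ..
    have good: "r \<cdot>\<^sub>m 1\<^sub>m d \<in> trilin_image d x1 x2 x3 z1 z2 z3"
      if "x1 + x2 + x3 = \<alpha>" "z1 + z2 + z3 = - \<alpha>" "x2 + x3 + z2 \<noteq> 0" "x2 + x3 + z2 \<noteq> - \<alpha>"
      for x1 x2 x3 z1 z2 z3
    proof (rule scalar_in_trilin_image)
      have x: "x2 + x3 = \<alpha> - x1" and z: "z1 + z3 = - \<alpha> - z2"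
        using that(1,2) by (auto simp: algebra_simps)
      \<comment> \<open>The constant \<open>x2 + x3 + z2\<close> is thus the only factor of the
        determinant that can vanish. If \<open>x2 + x3\<close> and \<open>z1 + z3\<close> were both
        zero, it would equal \<open>- \<alpha>\<close>.\<close>
      have "(z1 + z3) * (x2 + x3) - x1 * z2 = - (\<alpha> * (x2 + x3 + z2))"
        unfolding x z by (simp add: algebra_simps)
      then show "(z1 + z3) * (x2 + x3) - x1 * z2 \<noteq> 0" using \<alpha>0 that(3) by simp
      show "x2 + x3 \<noteq> 0 \<or> z1 + z3 \<noteq> 0" using that(4) z by auto
    qed (rule d)
    \<comment> \<open>Otherwise \<open>c1 + c2 + c3\<close> would be one of \<open>0\<close>, \<open>- \<alpha>\<close>, \<open>- 2 \<alpha>\<close>, \<open>- 3 \<alpha>\<close>.\<close>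
    have "(c1 \<noteq> 0 \<and> c1 \<noteq> - \<alpha>) \<or> (c2 \<noteq> 0 \<and> c2 \<noteq> - \<alpha>) \<or> (c3 \<noteq> 0 \<and> c3 \<noteq> - \<alpha>)"
    proof (rule ccontr)
      assume "\<not> ?thesis"
      then have "\<exists>n::nat. c1 + c2 + c3 = - (of_nat n * \<alpha>)"
        by (auto intro: exI[of _ 0] exI[of _ 1] exI[of _ 2] exI[of _ 3])
      then obtain n :: nat where "\<alpha> = - (of_nat n * \<alpha>)" using csum by auto
      then have "\<alpha> + of_nat n * \<alpha> = 0" by (rule eq_neg_iff_add_eq_0[THEN iffD1])
      moreover have "\<alpha> + of_nat n * \<alpha> = of_nat (Suc n) * \<alpha>" by (simp add: distrib_right)
      ultimately show False using \<alpha>0 by (metis mult_eq_0_iff of_nat_neq_0)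
    qed
    moreover have "A \<in> trilin_image d a1 a2 a3 b1 b2 b3" if "c2 \<noteq> 0" "c2 \<noteq> - \<alpha>"
      unfolding r by (rule good) (use that b in \<open>simp_all add: c2_def \<alpha>_def\<close>)
    moreover have "A \<in> trilin_image d a2 a3 a1 b3 b1 b2" if "c3 \<noteq> 0" "c3 \<noteq> - \<alpha>"
      unfolding r by (rule good) (use that b in \<open>simp_all add: c3_def \<alpha>_def ac_simps\<close>)
    moreover have "A \<in> trilin_image d a3 a1 a2 b2 b3 b1" if "c1 \<noteq> 0" "c1 \<noteq> - \<alpha>"
      unfolding r by (rule good) (use that b in \<open>simp_all add: c1_def \<alpha>_def ac_simps\<close>)
    ultimately show ?thesis using rotate by blast
  qed
qed

lemma trilin_image_cases:
  fixes a1 a2 a3 b1 b2 b3 :: "'a::field_char_0"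
  assumes nz: "(a1, a2, a3, b1, b2, b3) \<noteq> (0, 0, 0, 0, 0, 0)"
  shows "trilin_image d a1 a2 a3 b1 b2 b3 = carrier_mat d d \<or>
    trilin_image d a1 a2 a3 b1 b2 b3 = {A \<in> carrier_mat d d. mat_trace A = 0}"
proof -
  define s where "s = a1 + a2 + a3 + b1 + b2 + b3"
  consider "s \<noteq> 0" | "s = 0" "a1 + a2 + a3 = 0 \<or> d \<le> 1" | "s = 0" "a1 + a2 + a3 \<noteq> 0" "d \<noteq> 1"
    by fastforce
  then show ?thesis
  proof cases
    case 1
    have "A \<in> trilin_image d a1 a2 a3 b1 b2 b3" if A: "A \<in> carrier_mat d d" for A
    proof -
      have "trilin a1 a2 a3 b1 b2 b3 A (1\<^sub>m d) (1\<^sub>m d) = s \<cdot>\<^sub>m A"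
        using A by (intro eq_matI) (auto simp: trilin_def s_def distrib_right)
      then have "s \<cdot>\<^sub>m A \<in> trilin_image d a1 a2 a3 b1 b2 b3"
        using trilin_imageI[OF A one_carrier_mat one_carrier_mat] by metis
      then have "(1 / s) \<cdot>\<^sub>m (s \<cdot>\<^sub>m A) \<in> trilin_image d a1 a2 a3 b1 b2 b3" by (rule trilin_image_smult)
      moreover have "(1 / s) \<cdot>\<^sub>m (s \<cdot>\<^sub>m A) = A" using 1 by (intro eq_matI) auto
      ultimately show ?thesis by simp
    qed
    then show ?thesis using trilin_image_carrier by blast
  next
    case 2
    have "mat_trace A = 0" if "A \<in> trilin_image d a1 a2 a3 b1 b2 b3" for A
      using mat_trace_trilin_image[OF that _ 2(2)] 2(1) by (simp add: s_def)
    moreover have "A \<in> trilin_image d a1 a2 a3 b1 b2 b3" if "A \<in> carrier_mat d d" "mat_trace A = 0" for A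
      using trace_zero_in_trilin_image[OF _ nz that] 2(1) by (simp add: s_def)
    ultimately show ?thesis using trilin_image_carrier by blast
  next
    case 3
    have "A \<in> trilin_image d a1 a2 a3 b1 b2 b3" if "A \<in> carrier_mat d d" for A
      using carrier_in_trilin_image[OF _ 3(2,3) that] 3(1) by (simp add: s_def)
    then show ?thesis using trilin_image_carrier by blast
  qed
qed

section \<open>The image in the free algebra formulation\<close>

lemma subspace_carrier_mat:
  "VectorSpace.subspace class_ring (carrier_mat n n) (module_mat TYPE('a::field) n n)"
proof -
  interpret vectorspace "class_ring :: 'a ring" "module_mat TYPE('a) n n" by (rule matrix_vs)
  show ?thesis
    unfolding VectorSpace.subspace_def submodule_def
    using matrix_vs module_axioms by (auto simp: module_mat_simps)
qed

lemma subspace_trace_zero: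
  "VectorSpace.subspace class_ring {A \<in> carrier_mat n n. mat_trace A = 0} (module_mat TYPE('a::field) n n)"
proof -
  interpret vectorspace "class_ring :: 'a ring" "module_mat TYPE('a) n n" by (rule matrix_vs)
  show ?thesis
    unfolding VectorSpace.subspace_def submodule_def
    using matrix_vs module_axioms
    by (auto simp: module_mat_simps mat_trace_add[of _ n] mat_trace_smult[of _ n])
      (simp add: mat_trace_def)
qed

text \<open>It is the identity elsewhere because \<open>permutes\<close> fixes all points outside
  the set, so permutations of \<open>{1, 2, 3}\<close> are literally of this form.\<close>

definition map123 :: "nat \<Rightarrow> nat \<Rightarrow> nat \<Rightarrow> nat \<Rightarrow> nat" where
  "map123 i j k = id(1 := i, 2 := j, 3 := k)"

lemma map123_simps [simp]:
  "map123 i j k 1 = i" "map123 i j k (Suc 0) = i" "map123 i j k 2 = j" "map123 i j k 3 = k"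
  by (simp_all add: map123_def)

lemma map123_eq_iff [simp]: "map123 i j k = map123 i' j' k' \<longleftrightarrow> i = i' \<and> j = j' \<and> k = k'"
  by (metis map123_simps)

lemma permutes_123:
  "{\<sigma>. \<sigma> permutes {1, 2, 3}} =
    {map123 1 2 3, map123 2 3 1, map123 3 1 2, map123 1 3 2, map123 3 2 1, map123 2 1 3}"
  (is "?P = ?M")
proof
  show "?P \<subseteq> ?M"
  proof
    fix \<sigma> assume "\<sigma> \<in> ?P"
    then have \<sigma>: "\<sigma> permutes {1, 2, 3}" by simp
    have eq: "map123 (\<sigma> 1) (\<sigma> 2) (\<sigma> 3) = \<sigma>"
      using permutes_not_in[OF \<sigma>] by (auto simp: map123_def fun_eq_iff)
    have "\<sigma> 1 \<in> {1, 2, 3}" "\<sigma> 2 \<in> {1, 2, 3}" "\<sigma> 3 \<in> {1, 2, 3}"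
      using permutes_in_image[OF \<sigma>] by blast+
    moreover have "\<sigma> 1 \<noteq> \<sigma> 2" "\<sigma> 1 \<noteq> \<sigma> 3" "\<sigma> 2 \<noteq> \<sigma> 3"
      using permutes_inj[OF \<sigma>] by (simp_all add: inj_eq)
    moreover have "map123 i j k \<in> ?M"
      if "i \<in> {1, 2, 3}" "j \<in> {1, 2, 3}" "k \<in> {1, 2, 3}" "i \<noteq> j" "i \<noteq> k" "j \<noteq> k" for i j k
      using that by auto
    ultimately have "map123 (\<sigma> 1) (\<sigma> 2) (\<sigma> 3) \<in> ?M" by blast
    then show "\<sigma> \<in> ?M" by (simp only: eq)
  qed
  have perm: "map123 i j k permutes {1, 2, 3}"
    if "{i, j, k} = {1, 2, 3}" "i \<noteq> j" "i \<noteq> k" "j \<noteq> k" for i j k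
  proof (rule bij_imp_permutes)
    show "bij_betw (map123 i j k) {1, 2, 3} {1, 2, 3}"
      using that by (simp add: bij_betw_def)
    show "map123 i j k x = x" if "x \<notin> {1, 2, 3}" for x using that by (simp add: map123_def)
  qed
  have "map123 1 2 3 \<in> ?P" "map123 2 3 1 \<in> ?P" "map123 3 1 2 \<in> ?P"
    "map123 1 3 2 \<in> ?P" "map123 3 2 1 \<in> ?P" "map123 2 1 3 \<in> ?P"
    by (rule CollectI, rule perm; auto)+
  then show "?M \<subseteq> ?P" by blast
qed

text \<open>Listing the six permutations in the coefficient order of \<open>trilin\<close> turns the
  evaluation into \<open>trilin\<close> at the values of the three variables.\<close>

lemma image3_multilinear:
  "image3 d (\<Sum>\<sigma> | \<sigma> permutes {1, 2, 3}. Const (a \<sigma>) * Var (\<sigma> 1) * Var (\<sigma> 2) * Var (\<sigma> 3)) =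
    trilin_image d (a (map123 1 2 3)) (a (map123 2 3 1)) (a (map123 3 1 2))
      (a (map123 1 3 2)) (a (map123 3 2 1)) (a (map123 2 1 3))"
  (is "image3 d ?f = trilin_image d ?a1 ?a2 ?a3 ?b1 ?b2 ?b3")
proof -
  have ev: "eval_mat d A ?f = trilin ?a1 ?a2 ?a3 ?b1 ?b2 ?b3 (A 1) (A 2) (A 3)"
    if A: "\<forall>i\<in>{1, 2, 3}. A i \<in> carrier_mat d d" for A
  proof -
    interpret M: abelian_group "module_mat TYPE(complex) d d" by (rule abelian_group_mat)
    define t where "t = (\<lambda>\<sigma>::nat \<Rightarrow> nat. a \<sigma> \<cdot>\<^sub>m (A (\<sigma> 1) * A (\<sigma> 2) * A (\<sigma> 3)))"
    have c: "t (map123 i j k) \<in> carrier_mat d d" if "i \<in> {1,2,3}" "j \<in> {1,2,3}" "k \<in> {1,2,3}" for i j k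
      using A that unfolding t_def map123_simps by (intro smult_carrier_mat mult_carrier_mat) blast+
    have t: "t (map123 1 2 3) \<in> carrier_mat d d" "t (map123 2 3 1) \<in> carrier_mat d d"
      "t (map123 3 1 2) \<in> carrier_mat d d" "t (map123 1 3 2) \<in> carrier_mat d d"
      "t (map123 3 2 1) \<in> carrier_mat d d" "t (map123 2 1 3) \<in> carrier_mat d d"
      by (rule c; simp)+
    have "eval_mat d A ?f = finsum (module_mat TYPE(complex) d d) t {\<sigma>. \<sigma> permutes {1, 2, 3}}"
      unfolding t_def by (rule eval_mat_multilinear[OF A])
    also have "\<dots> = t (map123 1 2 3) + (t (map123 2 3 1) + (t (map123 3 1 2) +
        (t (map123 1 3 2) + (t (map123 3 2 1) + t (map123 2 1 3)))))"
      unfolding permutes_123 using t by (simp add: M.finsum_insert module_mat_simps)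
    also have "\<dots> = t (map123 1 2 3) + t (map123 2 3 1) + t (map123 3 1 2) +
        t (map123 1 3 2) + t (map123 3 2 1) + t (map123 2 1 3)"
      using t by (simp add: assoc_add_mat[of _ d d])
    finally show ?thesis by (simp add: t_def trilin_def)
  qed
  show ?thesis
  proof
    show "image3 d ?f \<subseteq> trilin_image d ?a1 ?a2 ?a3 ?b1 ?b2 ?b3"
    proof
      fix B assume "B \<in> image3 d ?f"
      then obtain A where "B = eval_mat d A ?f" and A: "\<forall>i\<in>{1, 2, 3}. A i \<in> carrier_mat d d"
        unfolding image3_def by blast
      then have "B = trilin ?a1 ?a2 ?a3 ?b1 ?b2 ?b3 (A 1) (A 2) (A 3)" using ev by simp
      then show "B \<in> trilin_image d ?a1 ?a2 ?a3 ?b1 ?b2 ?b3"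
        using A by (simp add: trilin_imageI)
    qed
    show "trilin_image d ?a1 ?a2 ?a3 ?b1 ?b2 ?b3 \<subseteq> image3 d ?f"
    proof
      fix B assume "B \<in> trilin_image d ?a1 ?a2 ?a3 ?b1 ?b2 ?b3"
      then obtain X Y Z where B: "B = trilin ?a1 ?a2 ?a3 ?b1 ?b2 ?b3 X Y Z"
        and XYZ: "X \<in> carrier_mat d d" "Y \<in> carrier_mat d d" "Z \<in> carrier_mat d d"
        unfolding trilin_image_def by blast
      \<comment> \<open>Indices other than 1, 2, 3 are also sent to \<open>Z\<close>, an arbitrary
        choice.\<close>
      define A where "A i = (if i = 1 then X else if i = 2 then Y else Z)" for i :: nat
      have A: "\<forall>i\<in>{1, 2, 3}. A i \<in> carrier_mat d d" using XYZ by (simp add: A_def)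
      have "A 1 = X" "A 2 = Y" "A 3 = Z" by (simp_all add: A_def)
      then have "eval_mat d A ?f = B" by (simp only: ev[OF A] B)
      then show "B \<in> image3 d ?f" unfolding image3_def using A by (intro CollectI exI[of _ A]) (simp only: simp_thms)
    qed
  qed
qed

theorem theorem1p2:
  fixes f :: "nat free_alg" and d :: nat
  assumes "multilinear_deg3 f"
  shows "(even d \<longrightarrow>
            VectorSpace.subspace class_ring (image3 d f) (module_mat TYPE(complex) d d)) \<and>
         (odd d \<and> d < 17 \<longrightarrow>
            VectorSpace.subspace class_ring (image3 d f) (module_mat TYPE(complex) d d))"
proof -
  obtain a \<sigma> where \<sigma>: "\<sigma> permutes {1, 2, 3}" "a \<sigma> \<noteq> 0"
    and f: "f = (\<Sum>\<sigma> | \<sigma> permutes {1, 2, 3}. Const (a \<sigma>) * Var (\<sigma> 1) * Var (\<sigma> 2) * Var (\<sigma> 3))"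
    using assms unfolding multilinear_deg3_def by blast
  have "\<sigma> \<in> {\<sigma>. \<sigma> permutes {1, 2, 3}}" using \<sigma>(1) by simp
  then have "(a (map123 1 2 3), a (map123 2 3 1), a (map123 3 1 2),
      a (map123 1 3 2), a (map123 3 2 1), a (map123 2 1 3)) \<noteq> (0, 0, 0, 0, 0, 0)"
    unfolding permutes_123 using \<sigma>(2) by auto
  from trilin_image_cases[OF this, of d]
  have "VectorSpace.subspace class_ring (image3 d f) (module_mat TYPE(complex) d d)"
    unfolding f image3_multilinear
    by (elim disjE) (simp_all only: subspace_carrier_mat subspace_trace_zero)
  then show ?thesis by blast
qed

end
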